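(* Consider the operator $S\in\mathcal L(\ell_3^2)$ represented by the matrix $$S=\begin{pmatrix} 8+\frac{i}{5} & 1\\[1mm] \frac65 & -8-\frac{i}{5}\end{pmatrix}.$$ Then $\operatorname{tr}S=0$ and $0\in W(S)$, but $W(S)$ is not star-shaped with centre $0$. More precisely, $6\in W(S)$ and $3\notin W(S)$. Hence $W(S)\cap[0,\infty)$ is not an interval, so $W(S)$ cannot be star-shaped with centre $0$.
   Context: $\ell_3^2$ is $\mathbb C^2$ with the norm $\|x\|_3=(|x_1|^3+|x_2|^3)^{1/3}$; matrices are identified with operators with respect to the standard basis. For $x=(x_1,x_2)$ put $J(x)=(x_1|x_1|,x_2|x_2|)$, regarded as an element of the dual $\ell_{3/2}^2$ via the pairing $\langle x,y\rangle=x_1\overline{y_1}+x_2\overline{y_2}$. The numerical range is $W(S)=\{\langle Sx,J(x)\rangle:\ x\in\ell_3^2,\ \|x\|_3=1\}$. A set $A\subset\mathbb C$ is star-shaped with centre $c\in A$ if $(1-t)c+tz\in A$ for all $z\in A$ and $t\in[0,1]$. *)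

theory Defs
  imports "HOL-Analysis.Analysis"
begin

definition l3_norm :: "complex ^ 2 \<Rightarrow> real" where
  "l3_norm x = root 3 (cmod (x $ 1) ^ 3 + cmod (x $ 2) ^ 3)"

text \<open>The sesquilinear pairing between $\ell_3^2$ and its dual $\ell_{3/2}^2$,
  conjugate-linear in the second argument (HOL-Analysis provides only the real inner
  product on \<^typ>\<open>complex ^ 2\<close>).\<close>

definition dual_pairing :: "complex ^ 2 \<Rightarrow> complex ^ 2 \<Rightarrow> complex" where
  "dual_pairing x y = x $ 1 * cnj (y $ 1) + x $ 2 * cnj (y $ 2)"

definition duality_map :: "complex ^ 2 \<Rightarrow> complex ^ 2" where
  "duality_map x = (\<chi> i. x $ i * complex_of_real (cmod (x $ i)))"

definition numerical_range :: "(complex ^ 2 \<Rightarrow> complex ^ 2) \<Rightarrow> complex set" where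
  "numerical_range T = {dual_pairing (T x) (duality_map x) | x. l3_norm x = 1}"

text \<open>\<^const>\<open>starlike\<close> only asserts that some centre exists; here the centre is prescribed.\<close>

definition star_shaped_with_centre :: "complex \<Rightarrow> complex set \<Rightarrow> bool" where
  "star_shaped_with_centre c A \<longleftrightarrow>
     c \<in> A \<and> (\<forall>z\<in>A. \<forall>t\<in>{0..1::real}. (1 - t) *\<^sub>R c + t *\<^sub>R z \<in> A)"

end

theory Submission
  imports Defs
begin

text \<open>
  Normalising a vector by its first coordinate turns the unit sphere into a family of circles.
  If \<open>x\<^sub>2 = t u x\<^sub>1\<close> with \<open>t \<ge> 0\<close> and \<open>\<bar>u\<bar> = 1\<close>, then for fixed \<open>t\<close> the values
  \<open>\<langle>S x, J x\<rangle>\<close> trace out an ellipse as \<open>u\<close> varies, so the numerical range is a union of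
  ellipses \<open>E\<^sub>t\<close> (together with the diagonal entry reached when \<open>x\<^sub>1 = 0\<close>). For the matrix at
  hand, \<open>(1 + t\<^sup>3) E\<^sub>t\<close> has centre \<open>(8 + \<i>/5) (1 - t\<^sup>3)\<close>, a real half-axis of length
  \<open>t (1 + 6t/5)\<close> and an imaginary one of length \<open>t \<bar>1 - 6t/5\<bar>\<close>.

  At \<open>t = 5/6\<close> the ellipse degenerates to a horizontal segment that misses the real line, because
  the centre has positive imaginary part. So the real points of \<open>W(S)\<close> come from parameters \<open>t\<close>
  on either side of \<open>5/6\<close>. The centre moves fast along the real direction (the factor \<open>8\<close>),
  hence parameters below \<open>5/6\<close> produce larger real points, such as \<open>6\<close>, those above \<open>5/6\<close> smaller
  ones, such as \<open>0\<close>, and a gap remains in between.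

  Points of the gap, such as \<open>3\<close>, are excluded by comparing the two coordinates: a real part
  equal to \<open>3\<close> forces \<open>2/3 < t < 7/8\<close>, and for these \<open>t\<close> the ellipse is too flat to reach the
  real line (\<open>three_not_on_ellipse\<close>). Points such as \<open>0\<close> and \<open>6\<close> are found by continuity: a real
  \<open>p\<close> lies strictly outside both degenerate members of the family, \<open>t = 0\<close> and \<open>t = 5/6\<close>, so
  as soon as some \<open>E\<^sub>t\<close> encloses \<open>p\<close>, another one passes through it
  (\<open>enclosed_imp_in_range\<close>).
\<close>

section \<open>The numerical range as a union of ellipses\<close>

lemma pairing_2x2:
  fixes a b c d :: complex and x :: "complex ^ 2"
  shows "dual_pairing (vector [vector [a, b], vector [c, d]] *v x) (duality_map x) =
    (a * x$1 + b * x$2) * cnj (x$1) * cmod (x$1) + (c * x$1 + d * x$2) * cnj (x$2) * cmod (x$2)"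
  by (simp add: dual_pairing_def duality_map_def matrix_vector_mult_def sum_2 vector_2 mult.assoc)

lemma l3_norm_eq_1_iff: "l3_norm x = 1 \<longleftrightarrow> cmod (x$1) ^ 3 + cmod (x$2) ^ 3 = 1"
  by (simp add: l3_norm_def)

lemma mult_cnj_mult_cmod: "w * cnj w * complex_of_real (cmod w) = of_real (cmod w ^ 3)"
  by (simp add: complex_norm_square[symmetric] power2_eq_square power3_eq_cube)

text \<open>The pairing is homogeneous of degree three in \<open>\<bar>x\<^sub>1\<bar>\<close> once \<open>x\<^sub>2 = t u x\<^sub>1\<close> is
  substituted; this is the parametrisation of the ellipses.\<close>

lemma pairing_parametrised:
  fixes a b c d u :: complex and x :: "complex ^ 2" and t :: real
  assumes "t \<ge> 0" "cmod u = 1" and x2: "x$2 = of_real t * u * x$1"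
  shows "dual_pairing (vector [vector [a, b], vector [c, d]] *v x) (duality_map x) =
    of_real (cmod (x$1) ^ 3) * (a + d * of_real (t ^ 3) + b * of_real t * u + c * of_real (t\<^sup>2) * cnj u)"
proof -
  have uu: "u * cnj u = 1"
    using assms(2) by (simp add: complex_norm_square[symmetric])
  have m2: "cmod (x$2) = t * cmod (x$1)"
    using assms by (simp add: norm_mult)
  have "dual_pairing (vector [vector [a, b], vector [c, d]] *v x) (duality_map x) =
     (x$1 * cnj (x$1) * cmod (x$1)) *
       (a + d * of_real (t ^ 3) * (u * cnj u) + b * of_real t * u + c * of_real (t\<^sup>2) * cnj u)"
    unfolding pairing_2x2 m2 unfolding x2
    by (simp add: algebra_simps power2_eq_square power3_eq_cube)
  thus ?thesis
    by (simp add: uu mult_cnj_mult_cmod)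
qed

lemma numerical_range_2x2_iff:
  fixes a b c d z :: complex
  shows "z \<in> numerical_range ((*v) (vector [vector [a, b], vector [c, d]])) \<longleftrightarrow>
    z = d \<or> (\<exists>t\<ge>0. \<exists>u. cmod u = 1 \<and>
      z * of_real (1 + t ^ 3) = a + d * of_real (t ^ 3) + b * of_real t * u + c * of_real (t\<^sup>2) * cnj u)"
    (is "?L \<longleftrightarrow> z = d \<or> ?R")
proof
  assume ?L
  then obtain x where x: "l3_norm x = 1"
    and z: "z = dual_pairing (vector [vector [a, b], vector [c, d]] *v x) (duality_map x)"
    by (auto simp: numerical_range_def)
  show "z = d \<or> ?R"
  proof (cases "x$1 = 0")
    case True
    have "z = d * (x$2 * cnj (x$2) * cmod (x$2))"
      unfolding z pairing_2x2 using True by simp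
    thus ?thesis
      using True x by (simp add: mult_cnj_mult_cmod l3_norm_eq_1_iff del: of_real_power)
  next
    case False
    define t where "t = cmod (x$2) / cmod (x$1)"
    \<comment> \<open>The phase of \<open>x\<^sub>2 / x\<^sub>1\<close> is arbitrary when \<open>x\<^sub>2 = 0\<close>, because then \<open>t = 0\<close>.\<close>
    define u where "u = (if x$2 = 0 then 1 else sgn (x$2 / x$1))"
    have t: "t \<ge> 0" by (simp add: t_def)
    have u: "cmod u = 1"
      using False norm_sgn[of "x$2 / x$1"]
      by (auto simp only: u_def norm_one divide_eq_0_iff split: if_split)
    have x2: "x$2 = of_real t * u * x$1"
      using False by (simp add: t_def u_def sgn_eq norm_divide)
    have nrm: "cmod (x$1) ^ 3 * (1 + t ^ 3) = 1"
      using x False by (simp add: l3_norm_eq_1_iff t_def field_simps)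
    have "z * of_real (1 + t ^ 3) = of_real (cmod (x$1) ^ 3 * (1 + t ^ 3)) *
       (a + d * of_real (t ^ 3) + b * of_real t * u + c * of_real (t\<^sup>2) * cnj u)"
      unfolding z pairing_parametrised[OF t u x2] of_real_mult by (simp only: mult_ac)
    thus ?thesis using t u unfolding nrm by auto
  qed
next
  assume "z = d \<or> ?R"
  thus ?L
  proof
    assume "z = d"
    moreover define x :: "complex ^ 2" where "x = vector [0, 1]"
    ultimately have "l3_norm x = 1"
      "z = dual_pairing (vector [vector [a, b], vector [c, d]] *v x) (duality_map x)"
      by (simp_all add: l3_norm_eq_1_iff pairing_2x2 vector_2)
    thus ?L unfolding numerical_range_def by blast
  next
    assume ?R
    then obtain t u where t: "t \<ge> 0" and u: "cmod u = 1" and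
      z: "z * of_real (1 + t ^ 3) =
        a + d * of_real (t ^ 3) + b * of_real t * u + c * of_real (t\<^sup>2) * cnj u"
      by blast
    have pos: "1 + t ^ 3 > 0" using t by (simp add: add_pos_nonneg)
    define r where "r = root 3 (1 / (1 + t ^ 3))"
    have r: "r \<ge> 0" "r ^ 3 = 1 / (1 + t ^ 3)"
      using pos by (simp_all add: r_def)
    define x :: "complex ^ 2" where "x = vector [of_real r, of_real t * u * of_real r]"
    have x1: "cmod (x$1) = r" and x2: "x$2 = of_real t * u * x$1"
      using r(1) by (simp_all add: x_def vector_2)
    have "cmod (x$1) ^ 3 + cmod (x$2) ^ 3 = r ^ 3 * (1 + t ^ 3)"
      using t u unfolding x2 by (simp add: x1 norm_mult power_mult_distrib algebra_simps)
    also have "\<dots> = 1" using r(2) pos by simp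
    finally have "l3_norm x = 1" by (simp add: l3_norm_eq_1_iff)
    moreover have "dual_pairing (vector [vector [a, b], vector [c, d]] *v x) (duality_map x) = z"
    proof -
      have "dual_pairing (vector [vector [a, b], vector [c, d]] *v x) (duality_map x) =
          of_real (r ^ 3) * (z * of_real (1 + t ^ 3))"
        unfolding pairing_parametrised[OF t u x2] x1 z ..
      also have "\<dots> = z * of_real (r ^ 3 * (1 + t ^ 3))"
        unfolding of_real_mult by (simp only: mult_ac)
      also have "r ^ 3 * (1 + t ^ 3) = 1" using r(2) pos by simp
      finally show ?thesis by simp
    qed
    ultimately show ?L unfolding numerical_range_def by blast
  qed
qed

section \<open>Real points of the numerical range\<close>

definition S_mat :: "complex ^ 2 ^ 2" where
  "S_mat = vector [vector [8 + \<i> / 5, 1], vector [6 / 5, - 8 - \<i> / 5]]"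

text \<open>Real and imaginary part of the equation of \<open>(1 + t\<^sup>3) E\<^sub>t\<close>, both multiplied by five; the point
  reached when \<open>x\<^sub>1 = 0\<close> is not real and drops out.\<close>

lemma real_in_range_iff:
  "complex_of_real p \<in> numerical_range ((*v) S_mat) \<longleftrightarrow>
    (\<exists>t\<ge>0. \<exists>c s. c\<^sup>2 + s\<^sup>2 = 1 \<and>
       5 * (p * (1 + t ^ 3) - 8 * (1 - t ^ 3)) = c * (t * (5 + 6 * t)) \<and>
       - (1 - t ^ 3) = s * (t * (5 - 6 * t)))" (is "_ \<longleftrightarrow> (\<exists>t\<ge>0. ?P t)")
proof -
  have eq: "(\<exists>u. cmod u = 1 \<and> of_real p * of_real (1 + t ^ 3) =
      8 + \<i> / 5 + (- 8 - \<i> / 5) * of_real (t ^ 3) + 1 * of_real t * u + 6 / 5 * of_real (t\<^sup>2) * cnj u)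
    \<longleftrightarrow> ?P t" (is "(\<exists>u. ?Q u) \<longleftrightarrow> _") for t :: real
  proof -
    have "?Q u \<longleftrightarrow> (Re u)\<^sup>2 + (Im u)\<^sup>2 = 1 \<and>
       5 * (p * (1 + t ^ 3) - 8 * (1 - t ^ 3)) = Re u * (t * (5 + 6 * t)) \<and>
       - (1 - t ^ 3) = Im u * (t * (5 - 6 * t))" for u
      unfolding cmod_def real_sqrt_eq_1_iff complex_eq_iff
      by (auto simp: algebra_simps power2_eq_square simp del: of_real_power)
    hence "(\<exists>u. ?Q u) \<longleftrightarrow> (\<exists>u. (Re u)\<^sup>2 + (Im u)\<^sup>2 = 1 \<and>
       5 * (p * (1 + t ^ 3) - 8 * (1 - t ^ 3)) = Re u * (t * (5 + 6 * t)) \<and>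
       - (1 - t ^ 3) = Im u * (t * (5 - 6 * t)))" by simp
    also have "\<dots> \<longleftrightarrow> ?P t"
      by (metis complex.sel)
    finally show ?thesis .
  qed
  have "complex_of_real p \<noteq> - 8 - \<i> / 5"
    by (simp add: complex_eq_iff)
  thus ?thesis
    unfolding S_mat_def numerical_range_2x2_iff using eq by blast
qed

text \<open>The equation of \<open>E\<^sub>t\<close> with cleared denominators, evaluated at the real point \<open>p\<close>: unless
  \<open>E\<^sub>t\<close> is degenerate, it is negative for \<open>p\<close> inside \<open>E\<^sub>t\<close>, zero on \<open>E\<^sub>t\<close> and positive outside.\<close>

definition ellipse_poly :: "real \<Rightarrow> real \<Rightarrow> real" where
  "ellipse_poly p t = 25 * (p * (1 + t ^ 3) - 8 * (1 - t ^ 3))\<^sup>2 * (5 - 6 * t)\<^sup>2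
     + (1 - t ^ 3)\<^sup>2 * (5 + 6 * t)\<^sup>2 - t\<^sup>2 * (5 + 6 * t)\<^sup>2 * (5 - 6 * t)\<^sup>2"

lemma ellipse_poly_pos_degenerate: "ellipse_poly p 0 > 0" "ellipse_poly p (5 / 6) > 0"
proof -
  have "ellipse_poly p 0 = 625 * (p - 8)\<^sup>2 + 25"
    by (simp add: ellipse_poly_def)
  thus "ellipse_poly p 0 > 0"
    using zero_le_power2[of "p - 8"] by linarith
qed (simp add: ellipse_poly_def power2_eq_square power3_eq_cube)

lemma ellipse_poly_zero_imp_in_range:
  assumes t: "t \<ge> 0" and zero: "ellipse_poly p t = 0"
  shows "complex_of_real p \<in> numerical_range ((*v) S_mat)"
proof -
  have "t \<noteq> 0" "t \<noteq> 5 / 6"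
    using zero ellipse_poly_pos_degenerate[of p] by (metis less_irrefl)+
  hence "t > 0" "5 - 6 * t \<noteq> 0"
    using t by linarith+
  hence nz: "t * (5 + 6 * t) \<noteq> 0" "t * (5 - 6 * t) \<noteq> 0"
    by simp_all
  define A where "A = 5 * (p * (1 + t ^ 3) - 8 * (1 - t ^ 3))"
  define B where "B = - (1 - t ^ 3)"
  define P where "P = t * (5 + 6 * t)"
  define Q where "Q = t * (5 - 6 * t)"
  have "A\<^sup>2 * Q\<^sup>2 + B\<^sup>2 * P\<^sup>2 - P\<^sup>2 * Q\<^sup>2 = t\<^sup>2 * ellipse_poly p t"
    unfolding A_def B_def P_def Q_def ellipse_poly_def power_mult_distrib power2_minus
    by (simp only: right_diff_distrib distrib_left mult_ac) simp
  hence "A\<^sup>2 * Q\<^sup>2 + B\<^sup>2 * P\<^sup>2 = P\<^sup>2 * Q\<^sup>2" using zero by simp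
  hence "(A / P)\<^sup>2 + (B / Q)\<^sup>2 = 1"
    using nz unfolding P_def[symmetric] Q_def[symmetric] by (simp add: field_simps)
  moreover have "A = A / P * P" "B = B / Q * Q"
    using nz unfolding P_def[symmetric] Q_def[symmetric] by simp_all
  ultimately show ?thesis
    unfolding real_in_range_iff using t unfolding A_def B_def P_def Q_def by blast
qed

text \<open>The point \<open>p\<close> lies outside the point ellipse \<open>t = 0\<close>, so by continuity it is crossed on the
  way to any ellipse that encloses it.\<close>

lemma enclosed_imp_in_range:
  assumes "t \<ge> 0" "ellipse_poly p t \<le> 0"
  shows "complex_of_real p \<in> numerical_range ((*v) S_mat)"
proof -
  have "\<exists>t0\<ge>0. t0 \<le> t \<and> ellipse_poly p t0 = 0"
  proof (rule IVT2')
    show "continuous_on {0..t} (ellipse_poly p)"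
      unfolding ellipse_poly_def by (intro continuous_intros)
  qed (use assms ellipse_poly_pos_degenerate[of p] in auto)
  thus ?thesis using ellipse_poly_zero_imp_in_range by blast
qed

section \<open>The gap around 3\<close>

text \<open>The first hypothesis confines \<open>t\<close> to a small interval around the degenerate value \<open>5/6\<close>. There
  the half-height of the ellipse is less than the height of its centre, contrary to the second
  hypothesis.\<close>

lemma three_not_on_ellipse:
  fixes t :: real
  assumes t: "t \<ge> 0"
    and re: "\<bar>5 * (3 * (1 + t ^ 3) - 8 * (1 - t ^ 3))\<bar> \<le> t * (5 + 6 * t)"
    and im: "\<bar>1 - t ^ 3\<bar> \<le> \<bar>t * (5 - 6 * t)\<bar>"
  shows False
proof -
  have re': "\<bar>55 * t ^ 3 - 25\<bar> \<le> t * (5 + 6 * t)"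
    using re by (simp add: algebra_simps)
  have "t > 2 / 3"
  proof (rule ccontr)
    assume "\<not> t > 2 / 3"
    hence t': "t \<le> 2 / 3" by simp
    have "t ^ 3 \<le> (2 / 3) ^ 3" "t\<^sup>2 \<le> (2 / 3)\<^sup>2"
      using t t' by (intro power_mono; simp)+
    hence "t ^ 3 \<le> 8 / 27" "t\<^sup>2 \<le> 4 / 9" by (simp_all add: power2_eq_square power3_eq_cube)
    moreover have "25 - 55 * t ^ 3 \<le> 5 * t + 6 * t\<^sup>2"
      using re' by (simp add: algebra_simps power2_eq_square)
    ultimately show False using t' by linarith
  qed
  moreover have "t < 7 / 8"
  proof (rule ccontr)
    assume "\<not> t < 7 / 8"
    hence t': "t \<ge> 7 / 8" by simp
    have "t\<^sup>2 \<ge> (7 / 8)\<^sup>2" using t' by (intro power_mono) auto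
    hence sq: "t\<^sup>2 \<ge> 49 / 64" by (simp add: power2_eq_square)
    have "t ^ 3 = t * t\<^sup>2" by (simp add: power2_eq_square power3_eq_cube)
    hence "t ^ 3 \<ge> 7 / 8 * t\<^sup>2" "t ^ 3 \<ge> t * (49 / 64)"
      using t' sq mult_right_mono[OF t', of "t\<^sup>2"] mult_left_mono[OF sq t] by simp_all
    moreover have "55 * t ^ 3 - 25 \<le> 5 * t + 6 * t\<^sup>2"
      using re' by (simp add: algebra_simps power2_eq_square)
    ultimately show False using t' sq by linarith
  qed
  ultimately have bounds: "0 < t - 2 / 3" "0 < 7 / 8 - t" by simp_all
  have "t ^ 3 < 1 ^ 3" using bounds t by (intro power_strict_mono) auto
  hence "1 - t ^ 3 \<le> t * (5 - 6 * t) \<or> 1 - t ^ 3 \<le> - (t * (5 - 6 * t))"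
    using im by linarith
  thus False
  proof
    assume *: "1 - t ^ 3 \<le> t * (5 - 6 * t)"
    \<comment> \<open>The right-hand side is the Taylor expansion of \<open>1 - t\<^sup>3 - t (5 - 6t)\<close> at \<open>2/3\<close>.\<close>
    have "0 < 1 / 27 + 5 / 3 * (t - 2 / 3) + (t - 2 / 3)\<^sup>2 * (4 - (t - 2 / 3))"
      using bounds by (intro add_pos_pos mult_pos_pos) auto
    also have "\<dots> = 1 - t ^ 3 - t * (5 - 6 * t)"
      by (simp add: field_simps power2_eq_square power3_eq_cube)
    finally show False using * by simp
  next
    assume *: "1 - t ^ 3 \<le> - (t * (5 - 6 * t))"
    \<comment> \<open>The right-hand side is the Taylor expansion of \<open>1 - t\<^sup>3 + t (5 - 6t)\<close> at \<open>7/8\<close>.\<close>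
    have "0 < 57 / 512 + (7 / 8 - t) * (499 / 64 - 69 / 8 * (7 / 8 - t)) + (7 / 8 - t) ^ 3"
      using bounds by (intro add_pos_pos mult_pos_pos) auto
    also have "\<dots> = 1 - t ^ 3 + t * (5 - 6 * t)"
      by (simp add: field_simps power2_eq_square power3_eq_cube)
    finally show False using * by simp
  qed
qed

theorem proposition2p10:
  fixes S :: "complex ^ 2 ^ 2"
  assumes S_def: "S = vector [vector [8 + \<i> / 5, 1], vector [6 / 5, - 8 - \<i> / 5]]"
  shows "trace S = 0
    \<and> 0 \<in> numerical_range ((*v) S)
    \<and> 6 \<in> numerical_range ((*v) S)
    \<and> 3 \<notin> numerical_range ((*v) S)
    \<and> \<not> is_interval {r::real. 0 \<le> r \<and> complex_of_real r \<in> numerical_range ((*v) S)}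
    \<and> \<not> star_shaped_with_centre 0 (numerical_range ((*v) S))"
proof -
  have S: "S = S_mat" by (simp add: S_def S_mat_def)
  have tr: "trace S = 0"
    by (simp add: S_def trace_def sum_2 vector_2)
  have zero: "0 \<in> numerical_range ((*v) S)"
    using enclosed_imp_in_range[of 1 0] by (simp add: S ellipse_poly_def)
  have six: "6 \<in> numerical_range ((*v) S)"
    using enclosed_imp_in_range[of "1 / 2" 6]
    by (simp add: S ellipse_poly_def power2_eq_square power3_eq_cube)
  have three: "3 \<notin> numerical_range ((*v) S)"
  proof
    assume "3 \<in> numerical_range ((*v) S)"
    hence "complex_of_real 3 \<in> numerical_range ((*v) S_mat)" by (simp add: S)
    then obtain t c s :: real where t: "t \<ge> 0" and cs: "c\<^sup>2 + s\<^sup>2 = 1"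
      and re: "5 * (3 * (1 + t ^ 3) - 8 * (1 - t ^ 3)) = c * (t * (5 + 6 * t))"
      and im: "- (1 - t ^ 3) = s * (t * (5 - 6 * t))"
      unfolding real_in_range_iff by blast
    have "c\<^sup>2 \<le> 1" "s\<^sup>2 \<le> 1"
      using cs zero_le_power2[of c] zero_le_power2[of s] by linarith+
    hence c: "\<bar>c\<bar> \<le> 1" and s: "\<bar>s\<bar> \<le> 1"
      by (simp_all add: abs_square_le_1)
    have "\<bar>c\<bar> * \<bar>t * (5 + 6 * t)\<bar> \<le> 1 * \<bar>t * (5 + 6 * t)\<bar>"
      using c by (intro mult_right_mono) auto
    hence "\<bar>5 * (3 * (1 + t ^ 3) - 8 * (1 - t ^ 3))\<bar> \<le> t * (5 + 6 * t)"
      unfolding re using t by (simp add: abs_mult)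
    moreover have "\<bar>s\<bar> * \<bar>t * (5 - 6 * t)\<bar> \<le> 1 * \<bar>t * (5 - 6 * t)\<bar>"
      using s by (intro mult_right_mono) auto
    hence "\<bar>1 - t ^ 3\<bar> \<le> \<bar>t * (5 - 6 * t)\<bar>"
      using abs_minus_cancel[of "1 - t ^ 3"] unfolding im by (simp add: abs_mult)
    ultimately show False using three_not_on_ellipse t by blast
  qed
  have "\<not> is_interval {r::real. 0 \<le> r \<and> complex_of_real r \<in> numerical_range ((*v) S)}"
    (is "\<not> is_interval ?I")
  proof
    assume "is_interval ?I"
    moreover have "0 \<in> ?I" "6 \<in> ?I" using zero six by simp_all
    ultimately have "3 \<in> ?I" by (rule mem_is_interval_1_I) simp_all
    thus False using three by simp
  qed
  moreover have "\<not> star_shaped_with_centre 0 (numerical_range ((*v) S))"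
  proof
    assume "star_shaped_with_centre 0 (numerical_range ((*v) S))"
    hence seg: "\<forall>t\<in>{0..1::real}. (1 - t) *\<^sub>R 0 + t *\<^sub>R 6 \<in> numerical_range ((*v) S)"
      using six unfolding star_shaped_with_centre_def by blast
    have "(1 - 1 / 2) *\<^sub>R 0 + (1 / 2 :: real) *\<^sub>R 6 \<in> numerical_range ((*v) S)"
      by (rule bspec[OF seg]) simp
    moreover have "(1 - 1 / 2) *\<^sub>R 0 + (1 / 2 :: real) *\<^sub>R 6 = (3 :: complex)"
      by (simp add: scaleR_conv_of_real)
    ultimately show False using three by simp
  qed
  ultimately show ?thesis using tr zero six three by blast
qed

end
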